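(* Let $\mathcal X,\mathcal Y$ be separable real Hilbert spaces and let $X\in L^2(\mathbb P;\mathcal X)$, $Y\in L^2(\mathbb P;\mathcal Y)$ be random variables on a common probability space. There exists an operator $\theta_\star\in L(\mathcal X,\mathcal Y)$ minimising $\mathbb E[\|Y-\theta X\|_{\mathcal Y}^2]$ over all $\theta\in L(\mathcal X,\mathcal Y)$ if and only if $C_{YX}\in\operatorname{ran}(A_{C_{XX}})$. The set of minimisers of $\theta\mapsto\mathbb E[\|Y-\theta X\|_{\mathcal Y}^2]$ over $L(\mathcal X,\mathcal Y)$ is exactly the set of solutions $\theta\in L(\mathcal X,\mathcal Y)$ of the equation $A_{C_{XX}}[\theta]=C_{YX}$.
   Context: $L(\mathcal X,\mathcal Y)$ is the space of bounded linear operators; $L^2(\mathbb P;\mathcal X)$ is the Bochner space. $y\otimes x$ is the rank-one operator $v\mapsto\langle x,v\rangle_{\mathcal X}y$. The (uncentred) covariance operators are $C_{YX}=\mathbb E[Y\otimes X]\colon\mathcal X\to\mathcal Y$ and $C_{XX}=\mathbb E[X\otimes X]\colon\mathcal X\to\mathcal X$. The precomposition operator is $A_{C_{XX}}\colon L(\mathcal X,\mathcal Y)\to L(\mathcal X,\mathcal Y)$, $A_{C_{XX}}[\theta]=\theta C_{XX}$. *)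

theory Defs
  imports "HOL-Probability.Probability"
begin

definition square_integrable_rv ::
    "'a measure \<Rightarrow> ('a \<Rightarrow> 'h::{real_inner, banach, second_countable_topology}) \<Rightarrow> bool" where
  "square_integrable_rv M X \<longleftrightarrow> X \<in> borel_measurable M \<and> integrable M (\<lambda>\<omega>. (norm (X \<omega>))\<^sup>2)"

text \<open>
  The library's \<open>has_bochner_integral\<close> carries the sort \<open>second_countable_topology\<close>, which the
  operator-norm topology on \<open>'x \<Rightarrow>\<^sub>L 'y\<close> violates in infinite dimension.
  The next two definitions repeat the library's definition of the Bochner integral without that sort.
\<close>

definition has_strong_integral ::
    "'a measure \<Rightarrow> ('a \<Rightarrow> 'b::real_normed_vector) \<Rightarrow> 'b \<Rightarrow> bool" where
  "has_strong_integral M f z \<longleftrightarrow> f \<in> borel_measurable M \<and>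
     (\<exists>s. (\<forall>i::nat. Bochner_Integration.simple_bochner_integrable M (s i)) \<and>
          (\<lambda>i. \<integral>\<^sup>+\<omega>. ennreal (norm (f \<omega> - s i \<omega>)) \<partial>M) \<longlonglongrightarrow> 0 \<and>
          (\<lambda>i. Bochner_Integration.simple_bochner_integral M (s i)) \<longlonglongrightarrow> z)"

definition strong_integral ::
    "'a measure \<Rightarrow> ('a \<Rightarrow> 'b::real_normed_vector) \<Rightarrow> 'b" where
  "strong_integral M f =
     (if \<exists>z. has_strong_integral M f z then THE z. has_strong_integral M f z else 0)"

lemma measurable_norm_diff_simple:
  fixes f :: "'a \<Rightarrow> 'b::real_normed_vector"
  assumes f: "f \<in> borel_measurable M" and s: "simple_function M s"
  shows "(\<lambda>x. ennreal (norm (f x - s x))) \<in> borel_measurable M"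
proof (rule measurable_compose_countable'[where I = "s ` space M" and g = s])
  fix c :: 'b
  have "continuous_on UNIV (\<lambda>y. norm (y - c))"
    by (intro continuous_intros)
  then have "(\<lambda>y. norm (y - c)) \<in> borel_measurable borel"
    by (rule borel_measurable_continuous_onI)
  from measurable_compose[OF f this]
  show "(\<lambda>x. ennreal (norm (f x - c))) \<in> borel_measurable M"
    by simp
next
  show "s \<in> measurable M (count_space (s ` space M))"
    using s by (auto simp: simple_function_def measurable_count_space_eq2)
  show "countable (s ` space M)"
    using s by (auto simp: simple_function_def intro: countable_finite)
qed

lemma simple_integral_dist_le:
  fixes f :: "'a \<Rightarrow> 'b::real_normed_vector"
  assumes f: "f \<in> borel_measurable M"
    and s: "Bochner_Integration.simple_bochner_integrable M s"
    and t: "Bochner_Integration.simple_bochner_integrable M t"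
  shows "ennreal (norm (Bochner_Integration.simple_bochner_integral M s -
            Bochner_Integration.simple_bochner_integral M t))
    \<le> (\<integral>\<^sup>+x. norm (f x - s x) \<partial>M) + (\<integral>\<^sup>+x. norm (f x - t x) \<partial>M)"
    (is "ennreal (norm (?s - ?t)) \<le> ?S + ?T")
proof -
  have meas: "(\<lambda>x. ennreal (norm (f x - s x))) \<in> borel_measurable M"
    "(\<lambda>x. ennreal (norm (f x - t x))) \<in> borel_measurable M"
    using s t measurable_norm_diff_simple[OF f]
    by (blast elim: Bochner_Integration.simple_bochner_integrable.cases)+
  have "ennreal (norm (?s - ?t)) =
      norm (Bochner_Integration.simple_bochner_integral M (\<lambda>x. s x - t x))"
    using s t by (subst simple_bochner_integral_diff) auto
  also have "\<dots> \<le> Bochner_Integration.simple_bochner_integral M (\<lambda>x. norm (s x - t x))"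
    using simple_bochner_integrable_compose2[of "(-)" M "s" "t"] s t
    by (auto intro!: simple_bochner_integral_norm_bound)
  also have "\<dots> = (\<integral>\<^sup>+x. norm (s x - t x) \<partial>M)"
    using simple_bochner_integrable_compose2[of "\<lambda>x y. norm (x - y)" M "s" "t"] s t
    by (auto intro!: simple_bochner_integral_eq_nn_integral)
  also have "\<dots> \<le> (\<integral>\<^sup>+x. ennreal (norm (f x - s x)) + ennreal (norm (f x - t x)) \<partial>M)"
  proof (rule nn_integral_mono)
    fix x
    have "norm (s x - t x) \<le> norm (f x - s x) + norm (f x - t x)"
      by (metis dual_order.refl norm_diff_triangle_le norm_minus_commute)
    then show "ennreal (norm (s x - t x)) \<le> ennreal (norm (f x - s x)) + ennreal (norm (f x - t x))"
      by (simp flip: ennreal_plus add: ennreal_leI)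
  qed
  also have "\<dots> = ?S + ?T"
    by (rule nn_integral_add[OF meas])
  finally show ?thesis .
qed

lemma has_strong_integral_unique:
  fixes f :: "'a \<Rightarrow> 'b::real_normed_vector"
  assumes "has_strong_integral M f a" and "has_strong_integral M f b"
  shows "a = b"
proof -
  let ?I = "Bochner_Integration.simple_bochner_integral M"
  from assms obtain s t where f: "f \<in> borel_measurable M"
    and s: "\<And>i. Bochner_Integration.simple_bochner_integrable M (s i)"
      "(\<lambda>i. \<integral>\<^sup>+x. ennreal (norm (f x - s i x)) \<partial>M) \<longlonglongrightarrow> 0" "(\<lambda>i::nat. ?I (s i)) \<longlonglongrightarrow> a"
    and t: "\<And>i. Bochner_Integration.simple_bochner_integrable M (t i)"
      "(\<lambda>i. \<integral>\<^sup>+x. ennreal (norm (f x - t i x)) \<partial>M) \<longlonglongrightarrow> 0" "(\<lambda>i::nat. ?I (t i)) \<longlonglongrightarrow> b"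
    unfolding has_strong_integral_def by auto
  have "(\<lambda>i. ennreal (norm (?I (s i) - ?I (t i)))) \<longlonglongrightarrow> 0"
  proof (rule tendsto_sandwich[OF _ _ tendsto_const])
    show "(\<lambda>i. (\<integral>\<^sup>+x. norm (f x - s i x) \<partial>M) + (\<integral>\<^sup>+x. norm (f x - t i x) \<partial>M)) \<longlonglongrightarrow> 0"
      using tendsto_add[OF s(2) t(2)] by simp
  qed (use simple_integral_dist_le[OF f s(1) t(1)] in auto)
  then have "(\<lambda>i. norm (?I (s i) - ?I (t i))) \<longlonglongrightarrow> 0"
    by (simp flip: ennreal_0 add: tendsto_ennreal_iff)
  moreover have "(\<lambda>i. norm (?I (s i) - ?I (t i))) \<longlonglongrightarrow> norm (a - b)"
    using s(3) t(3) by (intro tendsto_intros)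
  ultimately have "norm (a - b) = 0"
    by (rule LIMSEQ_unique[symmetric])
  then show "a = b" by simp
qed

lemma strong_integral_eqI: "has_strong_integral M f z \<Longrightarrow> strong_integral M f = z"
  unfolding strong_integral_def by (auto intro!: the_equality dest: has_strong_integral_unique)

lemma has_strong_integral_iff_has_bochner_integral:
  fixes f :: "'a \<Rightarrow> 'b::{real_normed_vector, second_countable_topology}"
  shows "has_strong_integral M f z \<longleftrightarrow> has_bochner_integral M f z"
  unfolding has_strong_integral_def has_bochner_integral.simps by auto

definition rank_one :: "'y::real_normed_vector \<Rightarrow> 'x::real_inner \<Rightarrow> 'x \<Rightarrow>\<^sub>L 'y" where
  "rank_one y x = blinfun_scaleR_left y o\<^sub>L blinfun_inner_right x"

lemma rank_one_apply [simp]: "rank_one y x v = (x \<bullet> v) *\<^sub>R y"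
  by (simp add: rank_one_def)

definition covariance_op ::
    "'a measure \<Rightarrow> ('a \<Rightarrow> 'y::real_normed_vector) \<Rightarrow> ('a \<Rightarrow> 'x::real_inner) \<Rightarrow> 'x \<Rightarrow>\<^sub>L 'y" where
  "covariance_op M Y X = strong_integral M (\<lambda>\<omega>. rank_one (Y \<omega>) (X \<omega>))"

lemma bounded_bilinear_rank_one: "bounded_bilinear rank_one"
  unfolding rank_one_def
  by (rule bounded_bilinear.comp[OF bounded_bilinear_blinfun_compose
        bounded_linear_blinfun_scaleR_left bounded_linear_blinfun_inner_right])

lemma norm_rank_one_le: "norm (rank_one y x) \<le> norm y * norm x"
proof (rule norm_blinfun_bound)
  fix v
  have "\<bar>x \<bullet> v\<bar> * norm y \<le> (norm x * norm v) * norm y"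
    by (intro mult_right_mono Cauchy_Schwarz_ineq2) auto
  then show "norm (rank_one y x v) \<le> norm y * norm x * norm v"
    by (simp add: ac_simps)
qed simp

text \<open>Square-integrability makes \<open>\<omega> \<mapsto> rank_one (Y \<omega>) (X \<omega>)\<close> integrable in operator norm, so the
  default value \<open>0\<close> in \<open>strong_integral\<close> is not used in \<open>covariance_op\<close>.\<close>

lemma has_strong_integral_covariance_op:
  fixes X :: "'a \<Rightarrow> 'x::{real_inner, banach, second_countable_topology}"
    and Y :: "'a \<Rightarrow> 'y::{real_inner, banach, second_countable_topology}"
  assumes "prob_space M" and X: "square_integrable_rv M X" and Y: "square_integrable_rv M Y"
  shows "has_strong_integral M (\<lambda>\<omega>. rank_one (Y \<omega>) (X \<omega>)) (covariance_op M Y X)"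
proof -
  interpret prob_space M by fact
  interpret R: bounded_bilinear "rank_one :: 'y \<Rightarrow> 'x \<Rightarrow> _" by (rule bounded_bilinear_rank_one)
  let ?f = "\<lambda>\<omega>. rank_one (Y \<omega>) (X \<omega>)"
  let ?I = "Bochner_Integration.simple_bochner_integral M :: ('a \<Rightarrow> 'x \<Rightarrow>\<^sub>L 'y) \<Rightarrow> _"
  have [measurable]: "X \<in> borel_measurable M" "Y \<in> borel_measurable M"
    using X Y by (auto simp: square_integrable_rv_def)
  obtain x where x: "\<And>i. simple_function M (x i)" "\<And>\<omega>. \<omega> \<in> space M \<Longrightarrow> (\<lambda>i. x i \<omega>) \<longlonglongrightarrow> X \<omega>"
      "\<And>i \<omega>. \<omega> \<in> space M \<Longrightarrow> norm (x i \<omega>) \<le> 2 * norm (X \<omega>)"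
    using borel_measurable_implies_sequence_metric[of X M 0] by simp metis
  obtain y where y: "\<And>i. simple_function M (y i)" "\<And>\<omega>. \<omega> \<in> space M \<Longrightarrow> (\<lambda>i. y i \<omega>) \<longlonglongrightarrow> Y \<omega>"
      "\<And>i \<omega>. \<omega> \<in> space M \<Longrightarrow> norm (y i \<omega>) \<le> 2 * norm (Y \<omega>)"
    using borel_measurable_implies_sequence_metric[of Y M 0] by simp metis
  define s where "s i \<omega> = rank_one (y i \<omega>) (x i \<omega>)" for i \<omega>
  have f: "?f \<in> borel_measurable M"
    by (rule borel_measurable_continuous_Pair) (auto intro!: R.continuous_on continuous_intros)
  have sf: "simple_function M (s i)" for i
    unfolding s_def by (rule simple_function_compose2[OF y(1) x(1)])
  then have sb: "Bochner_Integration.simple_bochner_integrable M (s i)" for i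
    by (intro Bochner_Integration.simple_bochner_integrable.intros) auto
  have bound: "norm (?f \<omega> - s i \<omega>) \<le> 5 * (norm (Y \<omega>) * norm (X \<omega>))" if "\<omega> \<in> space M" for i \<omega>
  proof -
    have "norm (s i \<omega>) \<le> norm (y i \<omega>) * norm (x i \<omega>)"
      unfolding s_def by (rule norm_rank_one_le)
    also have "\<dots> \<le> (2 * norm (Y \<omega>)) * (2 * norm (X \<omega>))"
      by (intro mult_mono x y that) auto
    finally have "norm (s i \<omega>) \<le> 4 * (norm (Y \<omega>) * norm (X \<omega>))" by simp
    moreover have "norm (?f \<omega>) \<le> norm (Y \<omega>) * norm (X \<omega>)" by (rule norm_rank_one_le)
    ultimately show ?thesis using norm_triangle_ineq4[of "?f \<omega>" "s i \<omega>"] by linarith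
  qed
  have "integrable M (\<lambda>\<omega>. (norm (Y \<omega>))\<^sup>2 + (norm (X \<omega>))\<^sup>2)"
    using X Y by (auto simp: square_integrable_rv_def)
  then have "integrable M (\<lambda>\<omega>. norm (Y \<omega>) * norm (X \<omega>))"
  proof (rule Bochner_Integration.integrable_bound)
    have "a * b \<le> a\<^sup>2 + b\<^sup>2" if "0 \<le> a" "0 \<le> b" for a b :: real
      using sum_squares_bound[of a b] mult_nonneg_nonneg[OF that] by linarith
    then show "AE \<omega> in M. norm (norm (Y \<omega>) * norm (X \<omega>)) \<le> norm ((norm (Y \<omega>))\<^sup>2 + (norm (X \<omega>))\<^sup>2)"
      by simp
  qed measurable
  then have "integrable M (\<lambda>\<omega>. 5 * (norm (Y \<omega>) * norm (X \<omega>)))" by simp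
  then have fin: "(\<integral>\<^sup>+\<omega>. ennreal (5 * (norm (Y \<omega>) * norm (X \<omega>))) \<partial>M) < \<infinity>"
    by (subst nn_integral_eq_integral) auto
  have lim: "(\<lambda>i. \<integral>\<^sup>+\<omega>. ennreal (norm (?f \<omega> - s i \<omega>)) \<partial>M) \<longlonglongrightarrow> 0"
  proof -
    have "(\<lambda>i. \<integral>\<^sup>+\<omega>. ennreal (norm (?f \<omega> - s i \<omega>)) \<partial>M) \<longlonglongrightarrow> (\<integral>\<^sup>+\<omega>. 0 \<partial>M)"
    proof (rule nn_integral_dominated_convergence[OF _ _ _ _ fin])
      show "AE \<omega> in M. (\<lambda>i. ennreal (norm (?f \<omega> - s i \<omega>))) \<longlonglongrightarrow> 0"
      proof (rule AE_I2)
        fix \<omega> assume "\<omega> \<in> space M"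
        then have "(\<lambda>i. norm (?f \<omega> - s i \<omega>)) \<longlonglongrightarrow> norm (?f \<omega> - ?f \<omega>)"
          unfolding s_def by (intro tendsto_intros R.tendsto x y)
        then show "(\<lambda>i. ennreal (norm (?f \<omega> - s i \<omega>))) \<longlonglongrightarrow> 0"
          by (simp flip: ennreal_0 add: tendsto_ennreal_iff)
      qed
    qed (use measurable_norm_diff_simple[OF f sf] X Y in \<open>auto intro!: AE_I2 bound ennreal_leI\<close>)
    then show ?thesis by simp
  qed
  have "Cauchy (\<lambda>i. ?I (s i))"
  proof (rule metric_CauchyI)
    fix e :: real assume e: "0 < e"
    then have "\<forall>\<^sub>F i in sequentially. (\<integral>\<^sup>+\<omega>. ennreal (norm (?f \<omega> - s i \<omega>)) \<partial>M) < ennreal (e / 2)"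
      using order_tendstoD(2)[OF lim, of "ennreal (e / 2)"] by simp
    then obtain N where N: "\<And>i. i \<ge> N \<Longrightarrow> (\<integral>\<^sup>+\<omega>. ennreal (norm (?f \<omega> - s i \<omega>)) \<partial>M) < ennreal (e / 2)"
      by (auto simp: eventually_sequentially)
    have "dist (?I (s i)) (?I (s j)) < e" if "i \<ge> N" "j \<ge> N" for i j
    proof -
      have "ennreal (norm (?I (s i) - ?I (s j))) < ennreal (e / 2) + ennreal (e / 2)"
        using simple_integral_dist_le[OF f sb sb, of i j] N[OF that(1)] N[OF that(2)]
        by (meson add_strict_mono order_le_less_trans)
      also have "\<dots> = ennreal e" using e by (simp flip: ennreal_plus)
      finally show ?thesis by (simp add: dist_norm ennreal_less_iff)
    qed
    then show "\<exists>N. \<forall>i\<ge>N. \<forall>j\<ge>N. dist (?I (s i)) (?I (s j)) < e" by blast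
  qed
  then obtain z where "(\<lambda>i. ?I (s i)) \<longlonglongrightarrow> z"
    using Cauchy_convergent convergent_def by blast
  then have "has_strong_integral M ?f z"
    unfolding has_strong_integral_def using f sb lim by blast
  then show ?thesis
    unfolding covariance_op_def by (simp add: strong_integral_eqI)
qed

definition precomposition ::
    "('x::real_normed_vector \<Rightarrow>\<^sub>L 'x) \<Rightarrow> ('x \<Rightarrow>\<^sub>L 'y::real_normed_vector) \<Rightarrow> ('x \<Rightarrow>\<^sub>L 'y)" where
  "precomposition C \<theta> = \<theta> o\<^sub>L C"

definition risk ::
    "'a measure \<Rightarrow> ('a \<Rightarrow> 'x::real_normed_vector) \<Rightarrow> ('a \<Rightarrow> 'y::real_normed_vector)
      \<Rightarrow> ('x \<Rightarrow>\<^sub>L 'y) \<Rightarrow> real" where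
  "risk M X Y \<theta> = (\<integral>\<omega>. (norm (Y \<omega> - \<theta> (X \<omega>)))\<^sup>2 \<partial>M)"

end

theory Submission
  imports Defs
begin

text \<open>
  Write \<open>R = Y - \<theta> X\<close> for the residual. Since
  \<open>E |R - H X|\<^sup>2 = E |R|\<^sup>2 - 2 E \<langle>R, H X\<rangle> + E |H X|\<^sup>2\<close>, the operator \<open>\<theta>\<close> minimises the risk iff
  \<open>E \<langle>R, H X\<rangle> = 0\<close> for all bounded \<open>H\<close>. Evaluating the covariance operators at a vector, which
  commutes with the operator-valued integral, turns the equation \<open>\<theta> C\<^sub>X\<^sub>X = C\<^sub>Y\<^sub>X\<close> into
  \<open>E [\<langle>X, v\<rangle> R] = 0\<close> for all \<open>v\<close>
  (\<open>normal_equation_iff_residual_uncorrelated\<close>). This is the same orthogonality, but only against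
  operators \<open>H\<close> of rank one, and hence of finite rank.

  So minimisers solve the equation by testing with \<open>H = w \<otimes> v\<close>. The converse must pass from
  finite rank to arbitrary bounded \<open>H\<close>. Finite-rank operators are not norm dense in infinite dimension,
  but strong convergence is enough: if \<open>P\<^sub>n\<close> projects onto the span of the first \<open>n + 1\<close> points of a
  dense sequence, then \<open>P\<^sub>n X \<rightarrow> X\<close> pointwise with \<open>|P\<^sub>n X| \<le> |X|\<close>, so
  \<open>0 = E \<langle>R, H P\<^sub>n X\<rangle> \<rightarrow> E \<langle>R, H X\<rangle>\<close> by dominated convergence
  (\<open>integral_inner_blinfun_eq_0\<close>).
\<close>

section \<open>Projections onto finite-dimensional subspaces\<close>

text \<open>
  For a finite pairwise orthogonal \<open>B\<close> this is the orthogonal projection onto \<open>span B\<close>. The vectors are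
  not normalised, and a zero vector in \<open>B\<close> contributes \<open>0\<close>, so any output of Gram-Schmidt can serve
  as \<open>B\<close>.
\<close>

definition span_projection :: "'h::real_inner set \<Rightarrow> 'h \<Rightarrow> 'h" where
  "span_projection B v = (\<Sum>b\<in>B. ((b \<bullet> v) / (b \<bullet> b)) *\<^sub>R b)"

lemma span_projection_in_span: "span_projection B v \<in> span B"
  unfolding span_projection_def by (intro span_sum span_scale span_base)

lemma orthogonal_span_projection_residual:
  assumes "finite B" "pairwise orthogonal B" "u \<in> span B"
  shows "orthogonal (v - span_projection B v) u"
proof (rule orthogonal_to_span[OF assms(3)])
  fix c assume c: "c \<in> B"
  have "span_projection B v \<bullet> c = (\<Sum>b\<in>B. if b = c then c \<bullet> v else 0)"
    unfolding span_projection_def inner_sum_left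
  proof (rule sum.cong)
    fix b assume b: "b \<in> B"
    show "((b \<bullet> v) / (b \<bullet> b)) *\<^sub>R b \<bullet> c = (if b = c then c \<bullet> v else 0)"
    proof (cases "b = c")
      case False
      then show ?thesis
        using b c assms(2) by (simp add: pairwise_def orthogonal_def)
    qed simp
  qed simp
  also have "\<dots> = c \<bullet> v" using assms(1) c by simp
  finally show "orthogonal (v - span_projection B v) c"
    by (simp add: orthogonal_def inner_diff_left inner_commute[of v])
qed

text \<open>The projection is the best approximation from the span: \<open>v - u\<close> splits into the residual of \<open>v\<close>
  and a vector of the span, which are orthogonal.\<close>

lemma norm_span_projection_residual_le:
  assumes "finite B" "pairwise orthogonal B" "u \<in> span B"
  shows "norm (v - span_projection B v) \<le> norm (v - u)"
proof -
  have "span_projection B v - u \<in> span B"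
    by (intro span_diff span_projection_in_span assms)
  then have "(norm (v - span_projection B v + (span_projection B v - u)))\<^sup>2 =
      (norm (v - span_projection B v))\<^sup>2 + (norm (span_projection B v - u))\<^sup>2"
    by (intro norm_add_Pythagorean orthogonal_span_projection_residual assms)
  then have "(norm (v - span_projection B v))\<^sup>2 \<le> (norm (v - u))\<^sup>2"
    by simp
  then show ?thesis by (rule power2_le_imp_le) simp
qed

lemma norm_span_projection_le:
  assumes "finite B" "pairwise orthogonal B"
  shows "norm (span_projection B v) \<le> norm v"
proof -
  have "(norm (v - span_projection B v + span_projection B v))\<^sup>2 =
      (norm (v - span_projection B v))\<^sup>2 + (norm (span_projection B v))\<^sup>2"
    by (intro norm_add_Pythagorean orthogonal_span_projection_residual span_projection_in_span assms)
  then have "(norm (span_projection B v))\<^sup>2 \<le> (norm v)\<^sup>2"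
    by simp
  then show ?thesis by (rule power2_le_imp_le) simp
qed

text \<open>
  The \<open>n\<close>-th span contains the points \<open>d 0, ..., d n\<close> of a dense sequence. Best approximation makes the
  error at \<open>v\<close> at most the distance from \<open>v\<close> to any one of them, and density makes some such distance small.
\<close>

lemma exists_span_projections_tendsto:
  obtains B :: "nat \<Rightarrow> 'h::{real_inner, second_countable_topology} set"
  where "\<And>n. finite (B n)" "\<And>n. pairwise orthogonal (B n)"
    "\<And>v. (\<lambda>n. span_projection (B n) v) \<longlonglongrightarrow> v"
proof -
  obtain D :: "'h set" where D: "countable D"
      "\<And>U. open U \<Longrightarrow> U \<noteq> {} \<Longrightarrow> \<exists>d\<in>D. d \<in> U"
    by (rule countable_dense_setE) blast
  have "D \<noteq> {}" using D(2)[of UNIV] by auto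
  define d where "d = from_nat_into D"
  have "\<exists>C. finite C \<and> span C = span (d ` {..n}) \<and> pairwise orthogonal C" for n
    using basis_orthogonal[of "d ` {..n}"] by auto
  then obtain B where B: "\<And>n. finite (B n)" "\<And>n. span (B n) = span (d ` {..n})"
      "\<And>n. pairwise orthogonal (B n)"
    by metis
  have "(\<lambda>n. span_projection (B n) v) \<longlonglongrightarrow> v" for v
  proof (rule LIMSEQ_I)
    fix e :: real assume "0 < e"
    then obtain c where c: "c \<in> D" "c \<in> ball v e"
      using D(2)[of "ball v e"] by auto
    then obtain k where k: "c = d k"
      unfolding d_def using from_nat_into_surj[OF D(1)] by metis
    have "norm (span_projection (B n) v - v) < e" if "n \<ge> k" for n
    proof -
      have "c \<in> span (B n)"
        unfolding B(2) k using that by (intro span_base) auto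
      then have "norm (v - span_projection (B n) v) \<le> norm (v - c)"
        by (intro norm_span_projection_residual_le B)
      then show ?thesis using c by (simp add: norm_minus_commute dist_norm)
    qed
    then show "\<exists>N. \<forall>n\<ge>N. norm (span_projection (B n) v - v) < e" by blast
  qed
  with B show thesis by (intro that)
qed

section \<open>Square-integrable random vectors\<close>

lemma square_integrable_rv_measurable:
  "square_integrable_rv M X \<Longrightarrow> X \<in> borel_measurable M"
  by (simp add: square_integrable_rv_def)

lemma square_integrable_rv_diff:
  assumes X: "square_integrable_rv M X" and Y: "square_integrable_rv M Y"
  shows "square_integrable_rv M (\<lambda>\<omega>. Y \<omega> - X \<omega>)"
  unfolding square_integrable_rv_def
proof
  have [measurable]: "X \<in> borel_measurable M" "Y \<in> borel_measurable M"
    using X Y by (auto intro: square_integrable_rv_measurable)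
  show "(\<lambda>\<omega>. Y \<omega> - X \<omega>) \<in> borel_measurable M" by measurable
  have "integrable M (\<lambda>\<omega>. 2 * (norm (Y \<omega>))\<^sup>2 + 2 * (norm (X \<omega>))\<^sup>2)"
    using X Y by (auto simp: square_integrable_rv_def)
  then show "integrable M (\<lambda>\<omega>. (norm (Y \<omega> - X \<omega>))\<^sup>2)"
  proof (rule Bochner_Integration.integrable_bound)
    have "(norm (Y \<omega> - X \<omega>))\<^sup>2 \<le> 2 * (norm (Y \<omega>))\<^sup>2 + 2 * (norm (X \<omega>))\<^sup>2" for \<omega>
    proof -
      have "(norm (Y \<omega> - X \<omega>))\<^sup>2 \<le> (norm (Y \<omega>) + norm (X \<omega>))\<^sup>2"
        by (intro power_mono norm_triangle_ineq4) simp
      also have "\<dots> \<le> 2 * (norm (Y \<omega>))\<^sup>2 + 2 * (norm (X \<omega>))\<^sup>2"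
        using sum_squares_bound[of "norm (Y \<omega>)" "norm (X \<omega>)"] by (simp add: power2_sum)
      finally show ?thesis .
    qed
    then show "AE \<omega> in M. norm ((norm (Y \<omega> - X \<omega>))\<^sup>2)
        \<le> norm (2 * (norm (Y \<omega>))\<^sup>2 + 2 * (norm (X \<omega>))\<^sup>2)"
      by (auto intro!: AE_I2)
  qed measurable
qed

lemma square_integrable_rv_blinfun:
  fixes \<theta> :: "'x::{real_inner, banach, second_countable_topology} \<Rightarrow>\<^sub>L
      'y::{real_inner, banach, second_countable_topology}"
  assumes X: "square_integrable_rv M X"
  shows "square_integrable_rv M (\<lambda>\<omega>. \<theta> (X \<omega>))"
  unfolding square_integrable_rv_def
proof
  have [measurable]: "X \<in> borel_measurable M"
    using X by (rule square_integrable_rv_measurable)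
  have [measurable]: "blinfun_apply \<theta> \<in> borel_measurable borel"
    by (intro borel_measurable_continuous_onI linear_continuous_on blinfun.bounded_linear_right)
  show "(\<lambda>\<omega>. \<theta> (X \<omega>)) \<in> borel_measurable M" by measurable
  have "integrable M (\<lambda>\<omega>. (norm \<theta>)\<^sup>2 * (norm (X \<omega>))\<^sup>2)"
    using X by (auto simp: square_integrable_rv_def)
  then show "integrable M (\<lambda>\<omega>. (norm (\<theta> (X \<omega>)))\<^sup>2)"
  proof (rule Bochner_Integration.integrable_bound)
    have "(norm (\<theta> (X \<omega>)))\<^sup>2 \<le> (norm \<theta>)\<^sup>2 * (norm (X \<omega>))\<^sup>2" for \<omega>
      using power_mono[OF norm_blinfun[of \<theta> "X \<omega>"], of 2] by (simp add: power_mult_distrib)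
    then show "AE \<omega> in M. norm ((norm (\<theta> (X \<omega>)))\<^sup>2) \<le> norm ((norm \<theta>)\<^sup>2 * (norm (X \<omega>))\<^sup>2)"
      by (auto intro!: AE_I2)
  qed measurable
qed

lemma integrable_norm_mult_norm:
  assumes X: "square_integrable_rv M X" and Y: "square_integrable_rv M Y"
  shows "integrable M (\<lambda>\<omega>. norm (X \<omega>) * norm (Y \<omega>))"
proof -
  have [measurable]: "X \<in> borel_measurable M" "Y \<in> borel_measurable M"
    using X Y by (auto intro: square_integrable_rv_measurable)
  have "integrable M (\<lambda>\<omega>. (norm (X \<omega>))\<^sup>2 + (norm (Y \<omega>))\<^sup>2)"
    using X Y by (auto simp: square_integrable_rv_def)
  then show ?thesis
  proof (rule Bochner_Integration.integrable_bound)
    have "a * b \<le> a\<^sup>2 + b\<^sup>2" if "0 \<le> a" "0 \<le> b" for a b :: real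
      using sum_squares_bound[of a b] mult_nonneg_nonneg[OF that] by linarith
    then show "AE \<omega> in M. norm (norm (X \<omega>) * norm (Y \<omega>)) \<le> norm ((norm (X \<omega>))\<^sup>2 + (norm (Y \<omega>))\<^sup>2)"
      by simp
  qed measurable
qed

lemma integrable_inner:
  assumes X: "square_integrable_rv M X" and Y: "square_integrable_rv M Y"
  shows "integrable M (\<lambda>\<omega>. X \<omega> \<bullet> Y \<omega>)"
proof (rule Bochner_Integration.integrable_bound[OF integrable_norm_mult_norm[OF X Y]])
  have [measurable]: "X \<in> borel_measurable M" "Y \<in> borel_measurable M"
    using X Y by (auto intro: square_integrable_rv_measurable)
  show "(\<lambda>\<omega>. X \<omega> \<bullet> Y \<omega>) \<in> borel_measurable M" by measurable
qed (auto intro!: AE_I2 simp: Cauchy_Schwarz_ineq2 abs_mult)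

section \<open>Covariance operators in weak form\<close>

text \<open>
  This carries the covariance operator from the space of operators, which need not be separable, to the
  separable space \<open>'y\<close>, where the theory of the Bochner integral is available: \<open>T\<close> will be evaluation
  at a vector. Approximating simple functions are mapped by \<open>T\<close> to approximating simple functions.
\<close>

lemma has_strong_integral_bounded_linear:
  fixes f :: "'a \<Rightarrow> 'b::real_normed_vector" and T :: "'b \<Rightarrow> 'c::real_normed_vector"
  assumes "bounded_linear T" and "has_strong_integral M f z"
  shows "has_strong_integral M (\<lambda>\<omega>. T (f \<omega>)) (T z)"
proof -
  interpret T: bounded_linear T by fact
  obtain s where f: "f \<in> borel_measurable M"
    and s: "\<And>i::nat. Bochner_Integration.simple_bochner_integrable M (s i)"
    and lim: "(\<lambda>i. \<integral>\<^sup>+\<omega>. ennreal (norm (f \<omega> - s i \<omega>)) \<partial>M) \<longlonglongrightarrow> 0"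
    and z: "(\<lambda>i. Bochner_Integration.simple_bochner_integral M (s i)) \<longlonglongrightarrow> z"
    using assms(2) unfolding has_strong_integral_def by auto
  have sf: "simple_function M (s i)" for i
    using s[of i] by (auto elim: Bochner_Integration.simple_bochner_integrable.cases)
  have "T \<in> borel_measurable borel"
    by (intro borel_measurable_continuous_onI T.continuous_on continuous_on_id)
  then have Tf: "(\<lambda>\<omega>. T (f \<omega>)) \<in> borel_measurable M"
    by (rule measurable_compose[OF f])
  have Ts: "Bochner_Integration.simple_bochner_integrable M (\<lambda>\<omega>. T (s i \<omega>))" for i
    by (rule simple_bochner_integrable_compose2[OF _ s s, where p = "\<lambda>x y. T x"]) simp
  obtain K where K: "K > 0" "\<And>x. norm (T x) \<le> norm x * K"
    using T.pos_bounded by auto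
  have bound: "(\<integral>\<^sup>+\<omega>. ennreal (norm (T (f \<omega>) - T (s i \<omega>))) \<partial>M)
      \<le> ennreal K * (\<integral>\<^sup>+\<omega>. ennreal (norm (f \<omega> - s i \<omega>)) \<partial>M)" for i
  proof -
    have "(\<integral>\<^sup>+\<omega>. ennreal (norm (T (f \<omega>) - T (s i \<omega>))) \<partial>M)
        \<le> (\<integral>\<^sup>+\<omega>. ennreal K * ennreal (norm (f \<omega> - s i \<omega>)) \<partial>M)"
      using K by (intro nn_integral_mono)
        (auto simp: T.diff[symmetric] mult.commute ennreal_mult[symmetric] intro!: ennreal_leI)
    also have "\<dots> = ennreal K * (\<integral>\<^sup>+\<omega>. ennreal (norm (f \<omega> - s i \<omega>)) \<partial>M)"
      by (rule nn_integral_cmult[OF measurable_norm_diff_simple[OF f sf]])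
    finally show ?thesis .
  qed
  have "(\<lambda>i. \<integral>\<^sup>+\<omega>. ennreal (norm (T (f \<omega>) - T (s i \<omega>))) \<partial>M) \<longlonglongrightarrow> 0"
  proof (rule tendsto_sandwich[OF _ _ tendsto_const])
    show "(\<lambda>i. ennreal K * (\<integral>\<^sup>+\<omega>. ennreal (norm (f \<omega> - s i \<omega>)) \<partial>M)) \<longlonglongrightarrow> 0"
      using ennreal_tendsto_cmult[OF _ lim, of "ennreal K"] by simp
  qed (use bound in auto)
  moreover have "(\<lambda>i. Bochner_Integration.simple_bochner_integral M (\<lambda>\<omega>. T (s i \<omega>))) \<longlonglongrightarrow> T z"
    using T.tendsto[OF z] by (simp add: simple_bochner_integral_linear[OF T.linear_axioms s])
  ultimately show ?thesis
    unfolding has_strong_integral_def using Tf Ts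
    by (intro conjI exI[where x = "\<lambda>i \<omega>. T (s i \<omega>)"]) auto
qed

lemma has_bochner_integral_covariance_op_apply:
  fixes X :: "'a \<Rightarrow> 'x::{real_inner, banach, second_countable_topology}"
    and Y :: "'a \<Rightarrow> 'y::{real_inner, banach, second_countable_topology}"
  assumes "prob_space M" "square_integrable_rv M X" "square_integrable_rv M Y"
  shows "has_bochner_integral M (\<lambda>\<omega>. (X \<omega> \<bullet> v) *\<^sub>R Y \<omega>) (covariance_op M Y X v)"
proof -
  have "has_strong_integral M (\<lambda>\<omega>. rank_one (Y \<omega>) (X \<omega>) v) (covariance_op M Y X v)"
    by (rule has_strong_integral_bounded_linear[OF blinfun.bounded_linear_left
          has_strong_integral_covariance_op[OF assms]])
  then show ?thesis by (simp add: has_strong_integral_iff_has_bochner_integral)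
qed

text \<open>Applied to \<open>v\<close>, the defect \<open>C\<^sub>Y\<^sub>X - \<theta> C\<^sub>X\<^sub>X\<close> of the equation is \<open>E [\<langle>X, v\<rangle> (Y - \<theta> X)]\<close>, because
  \<open>\<theta>\<close> commutes with the integral.\<close>

lemma normal_equation_iff_residual_uncorrelated:
  fixes X :: "'a \<Rightarrow> 'x::{real_inner, banach, second_countable_topology}"
    and Y :: "'a \<Rightarrow> 'y::{real_inner, banach, second_countable_topology}"
  assumes P: "prob_space M" and X: "square_integrable_rv M X" and Y: "square_integrable_rv M Y"
  shows "precomposition (covariance_op M X X) \<theta> = covariance_op M Y X \<longleftrightarrow>
    (\<forall>v. has_bochner_integral M (\<lambda>\<omega>. (X \<omega> \<bullet> v) *\<^sub>R (Y \<omega> - \<theta> (X \<omega>))) 0)"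
proof -
  have res: "has_bochner_integral M (\<lambda>\<omega>. (X \<omega> \<bullet> v) *\<^sub>R (Y \<omega> - \<theta> (X \<omega>)))
      (covariance_op M Y X v - \<theta> (covariance_op M X X v))" for v
  proof -
    have "has_bochner_integral M (\<lambda>\<omega>. \<theta> ((X \<omega> \<bullet> v) *\<^sub>R X \<omega>)) (\<theta> (covariance_op M X X v))"
      by (rule has_bochner_integral_bounded_linear[OF blinfun.bounded_linear_right
            has_bochner_integral_covariance_op_apply[OF P X X]])
    from has_bochner_integral_diff[OF has_bochner_integral_covariance_op_apply[OF P X Y] this]
    show ?thesis by (simp add: blinfun.scaleR_right scaleR_diff_right)
  qed
  show ?thesis
  proof
    assume eq: "precomposition (covariance_op M X X) \<theta> = covariance_op M Y X"
    have "\<theta> (covariance_op M X X v) = covariance_op M Y X v" for v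
      unfolding eq[symmetric] by (simp add: precomposition_def)
    then show "\<forall>v. has_bochner_integral M (\<lambda>\<omega>. (X \<omega> \<bullet> v) *\<^sub>R (Y \<omega> - \<theta> (X \<omega>))) 0"
      using res by simp
  next
    assume "\<forall>v. has_bochner_integral M (\<lambda>\<omega>. (X \<omega> \<bullet> v) *\<^sub>R (Y \<omega> - \<theta> (X \<omega>))) 0"
    then have "covariance_op M Y X v - \<theta> (covariance_op M X X v) = 0" for v
      using has_bochner_integral_eq[OF res] by blast
    then show "precomposition (covariance_op M X X) \<theta> = covariance_op M Y X"
      by (intro blinfun_eqI) (simp add: precomposition_def)
  qed
qed

section \<open>First-order optimality for the risk\<close>

lemma risk_add:
  fixes X :: "'a \<Rightarrow> 'x::{real_inner, banach, second_countable_topology}"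
    and Y :: "'a \<Rightarrow> 'y::{real_inner, banach, second_countable_topology}"
  assumes X: "square_integrable_rv M X" and Y: "square_integrable_rv M Y"
  shows "risk M X Y (\<theta> + H) = risk M X Y \<theta>
    - 2 * (\<integral>\<omega>. (Y \<omega> - \<theta> (X \<omega>)) \<bullet> H (X \<omega>) \<partial>M) + (\<integral>\<omega>. (norm (H (X \<omega>)))\<^sup>2 \<partial>M)"
proof -
  have R: "square_integrable_rv M (\<lambda>\<omega>. Y \<omega> - \<theta> (X \<omega>))" and H: "square_integrable_rv M (\<lambda>\<omega>. H (X \<omega>))"
    by (intro square_integrable_rv_diff square_integrable_rv_blinfun X Y)+
  have "(norm (Y \<omega> - (\<theta> + H) (X \<omega>)))\<^sup>2 = (norm (Y \<omega> - \<theta> (X \<omega>)))\<^sup>2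
      - 2 * ((Y \<omega> - \<theta> (X \<omega>)) \<bullet> H (X \<omega>)) + (norm (H (X \<omega>)))\<^sup>2" for \<omega>
    by (simp add: power2_norm_eq_inner blinfun.add_left inner_diff_left inner_diff_right
        inner_add_left inner_add_right inner_commute algebra_simps)
  then show ?thesis
    unfolding risk_def using R H integrable_inner[OF R H]
    by (simp add: square_integrable_rv_def)
qed

text \<open>
  The step from finite rank to bounded \<open>H\<close>. Each \<open>H P\<^sub>n\<close> is a finite sum of rank-one operators, for
  which the hypothesis gives the claim. The limit is taken under the integral with the majorant
  \<open>|H| |R| |X|\<close>, integrable because \<open>X\<close> and \<open>R\<close> are square integrable.
\<close>

lemma integral_inner_blinfun_eq_0:
  fixes X :: "'a \<Rightarrow> 'x::{real_inner, banach, second_countable_topology}"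
    and R :: "'a \<Rightarrow> 'y::{real_inner, banach, second_countable_topology}"
    and H :: "'x \<Rightarrow>\<^sub>L 'y"
  assumes X: "square_integrable_rv M X" and R: "square_integrable_rv M R"
    and uncorrelated: "\<And>v. has_bochner_integral M (\<lambda>\<omega>. (X \<omega> \<bullet> v) *\<^sub>R R \<omega>) 0"
  shows "(\<integral>\<omega>. R \<omega> \<bullet> H (X \<omega>) \<partial>M) = 0"
proof -
  have [measurable]: "X \<in> borel_measurable M" "R \<in> borel_measurable M"
    using X R by (auto intro: square_integrable_rv_measurable)
  have [measurable]: "blinfun_apply H \<in> borel_measurable borel"
    by (intro borel_measurable_continuous_onI linear_continuous_on blinfun.bounded_linear_right)
  obtain B :: "nat \<Rightarrow> 'x set" where B: "\<And>n. finite (B n)" "\<And>n. pairwise orthogonal (B n)"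
      "\<And>v. (\<lambda>n. span_projection (B n) v) \<longlonglongrightarrow> v"
    by (rule exists_span_projections_tendsto) blast
  have zero: "has_bochner_integral M (\<lambda>\<omega>. R \<omega> \<bullet> H (span_projection (B n) (X \<omega>))) 0" for n
  proof -
    have "has_bochner_integral M (\<lambda>\<omega>. ((X \<omega> \<bullet> b) *\<^sub>R R \<omega>) \<bullet> (H b /\<^sub>R (b \<bullet> b))) (0 \<bullet> (H b /\<^sub>R (b \<bullet> b)))" for b
      by (intro has_bochner_integral_inner_left uncorrelated)
    then have "has_bochner_integral M (\<lambda>\<omega>. \<Sum>b\<in>B n. ((X \<omega> \<bullet> b) *\<^sub>R R \<omega>) \<bullet> (H b /\<^sub>R (b \<bullet> b)))
        (\<Sum>b\<in>B n. 0 \<bullet> (H b /\<^sub>R (b \<bullet> b)))"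
      by (intro has_bochner_integral_sum)
    moreover have "(\<Sum>b\<in>B n. ((X \<omega> \<bullet> b) *\<^sub>R R \<omega>) \<bullet> (H b /\<^sub>R (b \<bullet> b)))
        = R \<omega> \<bullet> H (span_projection (B n) (X \<omega>))" for \<omega>
      by (simp add: span_projection_def blinfun.sum_right blinfun.scaleR_right inner_sum_right
          inner_commute divide_inverse mult_ac)
    ultimately show ?thesis by simp
  qed
  have "(\<lambda>n. \<integral>\<omega>. R \<omega> \<bullet> H (span_projection (B n) (X \<omega>)) \<partial>M) \<longlonglongrightarrow> (\<integral>\<omega>. R \<omega> \<bullet> H (X \<omega>) \<partial>M)"
  proof (rule integral_dominated_convergence[where w = "\<lambda>\<omega>. norm H * (norm (R \<omega>) * norm (X \<omega>))"])
    show "(\<lambda>\<omega>. R \<omega> \<bullet> H (span_projection (B n) (X \<omega>))) \<in> borel_measurable M" for n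
      using zero by (rule borel_measurable_has_bochner_integral)
    show "integrable M (\<lambda>\<omega>. norm H * (norm (R \<omega>) * norm (X \<omega>)))"
      by (intro integrable_mult_right integrable_norm_mult_norm R X)
    show "AE \<omega> in M. (\<lambda>n. R \<omega> \<bullet> H (span_projection (B n) (X \<omega>))) \<longlonglongrightarrow> R \<omega> \<bullet> H (X \<omega>)"
      by (intro AE_I2 tendsto_intros B)
    show "AE \<omega> in M. norm (R \<omega> \<bullet> H (span_projection (B n) (X \<omega>))) \<le> norm H * (norm (R \<omega>) * norm (X \<omega>))" for n
    proof (rule AE_I2)
      fix \<omega>
      have "norm (R \<omega> \<bullet> H (span_projection (B n) (X \<omega>))) \<le> norm (R \<omega>) * norm (H (span_projection (B n) (X \<omega>)))"
        by (simp add: Cauchy_Schwarz_ineq2)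
      also have "\<dots> \<le> norm (R \<omega>) * (norm H * norm (span_projection (B n) (X \<omega>)))"
        by (intro mult_left_mono norm_blinfun) simp
      also have "\<dots> \<le> norm (R \<omega>) * (norm H * norm (X \<omega>))"
        by (intro mult_left_mono norm_span_projection_le B) simp_all
      finally show "norm (R \<omega> \<bullet> H (span_projection (B n) (X \<omega>))) \<le> norm H * (norm (R \<omega>) * norm (X \<omega>))"
        by (simp add: mult_ac)
    qed
  qed measurable
  then show ?thesis
    by (simp add: has_bochner_integral_integral_eq[OF zero] LIMSEQ_const_iff)
qed

lemma linear_coefficient_eq_0:
  fixes a b :: real
  assumes "\<And>t. 0 \<le> t\<^sup>2 * a - 2 * t * b"
  shows "b = 0"
proof (rule ccontr)
  assume b: "b \<noteq> 0"
  \<comment> \<open>Any \<open>c > 0\<close> with \<open>a < 2 c\<close> makes the quadratic negative at \<open>t = b / c\<close>; if \<open>a > 0\<close>, its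
    minimum is at \<open>c = a\<close>, and the choice below also covers \<open>a \<le> 0\<close>.\<close>
  define c where "c = \<bar>a\<bar> + 1"
  have c: "c > 0" "a < 2 * c" by (auto simp: c_def)
  have "(b / c)\<^sup>2 * a - 2 * (b / c) * b = (b / c)\<^sup>2 * (a - 2 * c)"
    using c by (simp add: field_simps power2_eq_square)
  also have "\<dots> < 0"
    using b c by (intro mult_pos_neg) auto
  finally show False using assms[of "b / c"] by simp
qed

text \<open>Along the line \<open>\<theta> + t H\<close> the risk is quadratic in \<open>t\<close> and minimal at \<open>t = 0\<close>, so its linear
  coefficient vanishes.\<close>

lemma minimiser_residual_orthogonal:
  fixes X :: "'a \<Rightarrow> 'x::{real_inner, banach, second_countable_topology}"
    and Y :: "'a \<Rightarrow> 'y::{real_inner, banach, second_countable_topology}"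
    and H :: "'x \<Rightarrow>\<^sub>L 'y"
  assumes X: "square_integrable_rv M X" and Y: "square_integrable_rv M Y"
    and min: "\<And>\<theta>'. risk M X Y \<theta> \<le> risk M X Y \<theta>'"
  shows "(\<integral>\<omega>. (Y \<omega> - \<theta> (X \<omega>)) \<bullet> H (X \<omega>) \<partial>M) = 0"
proof (rule linear_coefficient_eq_0)
  fix t :: real
  have "risk M X Y \<theta> \<le> risk M X Y (\<theta> + t *\<^sub>R H)" by (rule min)
  then show "0 \<le> t\<^sup>2 * (\<integral>\<omega>. (norm (H (X \<omega>)))\<^sup>2 \<partial>M)
      - 2 * t * (\<integral>\<omega>. (Y \<omega> - \<theta> (X \<omega>)) \<bullet> H (X \<omega>) \<partial>M)"
    by (simp add: risk_add[OF X Y] blinfun.scaleR_left power_mult_distrib)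
qed

lemma is_arg_min_risk_iff_normal_equation:
  fixes X :: "'a \<Rightarrow> 'x::{real_inner, banach, second_countable_topology}"
    and Y :: "'a \<Rightarrow> 'y::{real_inner, banach, second_countable_topology}"
  assumes P: "prob_space M" and X: "square_integrable_rv M X" and Y: "square_integrable_rv M Y"
  shows "is_arg_min (risk M X Y) (\<lambda>_. True) \<theta> \<longleftrightarrow>
    precomposition (covariance_op M X X) \<theta> = covariance_op M Y X"
  unfolding normal_equation_iff_residual_uncorrelated[OF assms]
proof
  have R: "square_integrable_rv M (\<lambda>\<omega>. Y \<omega> - \<theta> (X \<omega>))"
    by (intro square_integrable_rv_diff square_integrable_rv_blinfun X Y)
  {
    assume "is_arg_min (risk M X Y) (\<lambda>_. True) \<theta>"
    then have min: "\<And>\<theta>'. risk M X Y \<theta> \<le> risk M X Y \<theta>'"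
      by (simp add: is_arg_min_def not_less)
    show "\<forall>v. has_bochner_integral M (\<lambda>\<omega>. (X \<omega> \<bullet> v) *\<^sub>R (Y \<omega> - \<theta> (X \<omega>))) 0"
    proof
      fix v
      let ?f = "\<lambda>\<omega>. (X \<omega> \<bullet> v) *\<^sub>R (Y \<omega> - \<theta> (X \<omega>))"
      have f: "has_bochner_integral M ?f (covariance_op M (\<lambda>\<omega>. Y \<omega> - \<theta> (X \<omega>)) X v)"
        (is "has_bochner_integral M ?f ?w")
        by (rule has_bochner_integral_covariance_op_apply[OF P X R])
      \<comment> \<open>Testing with the rank-one operator built from \<open>?w = E [\<langle>X, v\<rangle> R]\<close> itself yields \<open>|?w|\<^sup>2 = 0\<close>.\<close>
      have "?w \<bullet> ?w = (\<integral>\<omega>. ?f \<omega> \<bullet> ?w \<partial>M)"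
        using has_bochner_integral_inner_left[OF f, of ?w] by (simp add: has_bochner_integral_iff)
      also have "\<dots> = (\<integral>\<omega>. (Y \<omega> - \<theta> (X \<omega>)) \<bullet> rank_one ?w v (X \<omega>) \<partial>M)"
        by (simp add: inner_commute)
      also have "\<dots> = 0"
        by (rule minimiser_residual_orthogonal[OF X Y min])
      finally show "has_bochner_integral M ?f 0" using f by simp
    qed
  next
    assume "\<forall>v. has_bochner_integral M (\<lambda>\<omega>. (X \<omega> \<bullet> v) *\<^sub>R (Y \<omega> - \<theta> (X \<omega>))) 0"
    then have orth: "(\<integral>\<omega>. (Y \<omega> - \<theta> (X \<omega>)) \<bullet> H (X \<omega>) \<partial>M) = 0" for H :: "'x \<Rightarrow>\<^sub>L 'y"
      by (intro integral_inner_blinfun_eq_0 X R) auto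
    have "risk M X Y \<theta> \<le> risk M X Y (\<theta> + H)" for H
      unfolding risk_add[OF X Y] orth by simp
    \<comment> \<open>Every competitor is \<open>\<theta> + H\<close> with \<open>H = \<theta>' - \<theta>\<close>.\<close>
    from this[of "_ - \<theta>"] have "risk M X Y \<theta> \<le> risk M X Y \<theta>'" for \<theta>'
      by simp
    then show "is_arg_min (risk M X Y) (\<lambda>_. True) \<theta>"
      by (simp add: is_arg_min_def not_less)
  }
qed

theorem proposition3p5:
  fixes M :: "'a measure"
    and X :: "'a \<Rightarrow> 'x::{real_inner, banach, second_countable_topology}"
    and Y :: "'a \<Rightarrow> 'y::{real_inner, banach, second_countable_topology}"
  assumes "prob_space M"
    and "square_integrable_rv M X"
    and "square_integrable_rv M Y"
  shows "((\<exists>\<theta>. is_arg_min (risk M X Y) (\<lambda>_. True) \<theta>) \<longleftrightarrow>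
           covariance_op M Y X \<in> range (precomposition (covariance_op M X X) :: ('x \<Rightarrow>\<^sub>L 'y) \<Rightarrow> _)) \<and>
         {\<theta>. is_arg_min (risk M X Y) (\<lambda>_. True) \<theta>} =
           {\<theta>. precomposition (covariance_op M X X) \<theta> = covariance_op M Y X}"
  unfolding is_arg_min_risk_iff_normal_equation[OF assms] by (auto simp: image_iff eq_commute)

end
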